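(* Let $G$ be a $K_2$-reducible bipartite graph. Then $G$ is sign-invertible if and only if the essential index of any pair of two vertices of $G$ is either $0$ or $1$.
   Context: A graph $G$ with adjacency matrix $A$ is sign-invertible if $A$ is invertible and every entry of $A^{-1}$ lies in $\{-1,0,1\}$. If $v$ is a vertex of degree one in a graph with unique neighbor $u$, a $K_2$-reduction deletes both $u$ and $v$. A graph is $K_2$-reducible if it can be reduced to the empty graph by a series of $K_2$-reductions. A $K_2$-reducible graph has a unique perfect matching, denoted $M$ (a bipartite graph is $K_2$-reducible if and only if it has a unique perfect matching). A perfect 2-matching of a graph is a spanning subgraph each of whose components is either a cycle or a single edge (the empty graph has the empty perfect 2-matching). An $(x,y)$-path $P$ of $G$ is feasible if $G-V(P)$ has a perfect 2-matching. For vertices $x,y$, let $\tau_o(x,y)$ be the number of feasible $(x,y)$-paths $P$ with $|E(P)\setminus M|\equiv 1\pmod 2$, and $\tau_e(x,y)$ the number of feasible $(x,y)$-paths $P$ with $|E(P)\setminus M|\equiv 0\pmod 2$. The essential index of $(x,y)$ is $|\tau_o(x,y)-\tau_e(x,y)|$. *)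

theory Defs
  imports Complex_Main "Jordan_Normal_Form.Matrix"
begin

datatype 'a ugraph = Graph (verts: "'a set") (edges: "'a set set")

definition finite_simple_graph :: "'a ugraph \<Rightarrow> bool" where
  "finite_simple_graph G \<longleftrightarrow>
     finite (verts G) \<and> (\<forall>e \<in> edges G. e \<subseteq> verts G \<and> card e = 2)"

definition bipartite :: "'a ugraph \<Rightarrow> bool" where
  "bipartite G \<longleftrightarrow>
     (\<exists>X Y. X \<union> Y = verts G \<and> X \<inter> Y = {} \<and>
        (\<forall>e \<in> edges G. \<exists>x \<in> X. \<exists>y \<in> Y. e = {x, y}))"

definition adjacent :: "'a ugraph \<Rightarrow> 'a \<Rightarrow> 'a \<Rightarrow> bool" where
  "adjacent G u v \<longleftrightarrow> {u, v} \<in> edges G"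

definition vertex_degree :: "'a ugraph \<Rightarrow> 'a \<Rightarrow> nat" where
  "vertex_degree G v = card {e \<in> edges G. v \<in> e}"

definition induced_subgraph :: "'a ugraph \<Rightarrow> 'a set \<Rightarrow> 'a ugraph" where
  "induced_subgraph G W = Graph (verts G \<inter> W) {e \<in> edges G. e \<subseteq> W}"

definition delete_verts :: "'a ugraph \<Rightarrow> 'a set \<Rightarrow> 'a ugraph" where
  "delete_verts G S = induced_subgraph G (verts G - S)"


(* Matrices are indexed by {0..<n}, so the adjacency matrix depends on an enumeration
   of the vertices. Another enumeration conjugates the matrix, and hence its inverse, by
   a permutation matrix, so the existential in sign_invertible does not depend on the
   choice of vs. The empty graph has the (invertible) 0 x 0 adjacency matrix. *)

definition adjacency_mat :: "'a ugraph \<Rightarrow> 'a list \<Rightarrow> real mat" where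
  "adjacency_mat G vs =
     mat (length vs) (length vs) (\<lambda>(i, j). if adjacent G (vs ! i) (vs ! j) then 1 else 0)"

definition sign_invertible_mat :: "real mat \<Rightarrow> bool" where
  "sign_invertible_mat A \<longleftrightarrow>
     invertible_mat A \<and>
     (\<forall>B. inverts_mat A B \<and> inverts_mat B A \<longrightarrow> elements_mat B \<subseteq> {-1, 0, 1})"

definition sign_invertible :: "'a ugraph \<Rightarrow> bool" where
  "sign_invertible G \<longleftrightarrow>
     (\<exists>vs. distinct vs \<and> set vs = verts G \<and> sign_invertible_mat (adjacency_mat G vs))"


inductive K2_reduction :: "'a ugraph \<Rightarrow> 'a ugraph \<Rightarrow> bool" where
  "v \<in> verts G \<Longrightarrow> vertex_degree G v = 1 \<Longrightarrow> adjacent G u v \<Longrightarrow>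
     K2_reduction G (delete_verts G {u, v})"

definition K2_reducible :: "'a ugraph \<Rightarrow> bool" where
  "K2_reducible G \<longleftrightarrow> K2_reduction\<^sup>*\<^sup>* G (Graph {} {})"

definition perfect_matching :: "'a ugraph \<Rightarrow> 'a set set \<Rightarrow> bool" where
  "perfect_matching G M \<longleftrightarrow> M \<subseteq> edges G \<and> (\<forall>v \<in> verts G. \<exists>!e. e \<in> M \<and> v \<in> e)"

(* Meaningful only if the perfect matching is unique, as it is for K2-reducible graphs. *)
definition unique_matching :: "'a ugraph \<Rightarrow> 'a set set" where
  "unique_matching G = (THE M. perfect_matching G M)"


definition component_of :: "'a ugraph \<Rightarrow> 'a \<Rightarrow> 'a ugraph" where
  "component_of H v = induced_subgraph H {w. (adjacent H)\<^sup>*\<^sup>* v w}"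

definition graph_components :: "'a ugraph \<Rightarrow> 'a ugraph set" where
  "graph_components H = component_of H ` verts H"

definition is_cycle_graph :: "'a ugraph \<Rightarrow> bool" where
  "is_cycle_graph C \<longleftrightarrow>
     (\<exists>vs. 3 \<le> length vs \<and> distinct vs \<and> verts C = set vs \<and>
        edges C = {{vs ! i, vs ! (Suc i mod length vs)} | i. i < length vs})"

definition is_single_edge_graph :: "'a ugraph \<Rightarrow> bool" where
  "is_single_edge_graph C \<longleftrightarrow> (\<exists>u v. u \<noteq> v \<and> verts C = {u, v} \<and> edges C = {{u, v}})"

definition spanning_subgraph :: "'a ugraph \<Rightarrow> 'a ugraph \<Rightarrow> bool" where
  "spanning_subgraph H G \<longleftrightarrow> verts H = verts G \<and> edges H \<subseteq> edges G"

definition perfect_2_matching :: "'a ugraph \<Rightarrow> 'a ugraph \<Rightarrow> bool" where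
  "perfect_2_matching G H \<longleftrightarrow>
     spanning_subgraph H G \<and>
     (\<forall>C \<in> graph_components H. is_cycle_graph C \<or> is_single_edge_graph C)"


(* A path from x to y is the list of its vertices in order. For fixed x and y such lists
   correspond one-to-one to the (x,y)-paths as subgraphs; for x = y the only path is [x]. *)

definition is_path :: "'a ugraph \<Rightarrow> 'a \<Rightarrow> 'a \<Rightarrow> 'a list \<Rightarrow> bool" where
  "is_path G x y p \<longleftrightarrow>
     p \<noteq> [] \<and> hd p = x \<and> last p = y \<and> distinct p \<and> set p \<subseteq> verts G \<and>
     successively (adjacent G) p"

definition path_edges :: "'a list \<Rightarrow> 'a set set" where
  "path_edges p = {{p ! i, p ! Suc i} | i. Suc i < length p}"

definition feasible_path :: "'a ugraph \<Rightarrow> 'a \<Rightarrow> 'a \<Rightarrow> 'a list \<Rightarrow> bool" where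
  "feasible_path G x y p \<longleftrightarrow>
     is_path G x y p \<and> (\<exists>H. perfect_2_matching (delete_verts G (set p)) H)"

definition tau_odd :: "'a ugraph \<Rightarrow> 'a \<Rightarrow> 'a \<Rightarrow> nat" where
  "tau_odd G x y =
     card {p. feasible_path G x y p \<and> odd (card (path_edges p - unique_matching G))}"

definition tau_even :: "'a ugraph \<Rightarrow> 'a \<Rightarrow> 'a \<Rightarrow> nat" where
  "tau_even G x y =
     card {p. feasible_path G x y p \<and> even (card (path_edges p - unique_matching G))}"

definition essential_index :: "'a ugraph \<Rightarrow> 'a \<Rightarrow> 'a \<Rightarrow> int" where
  "essential_index G x y = \<bar>int (tau_odd G x y) - int (tau_even G x y)\<bar>"

end

theory Submission
  imports Defs "Jordan_Normal_Form.Determinant"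
begin

text \<open>Let \<open>M\<close> be the unique perfect matching and \<open>m x\<close> the partner of
  \<open>x\<close>. Since \<open>G\<close> is bipartite, the feasible paths are precisely the
  \<open>M\<close>-alternating paths that start and end with an edge of \<open>M\<close>: the perfect
  2-matching of the complement yields a second matching unless the path alternates. Let
  \<open>F x y\<close> be the sum of the signs \<open>(-1)^|E(P) - M|\<close> over the feasible
  \<open>(x, y)\<close>-paths \<open>P\<close>, so that its absolute value is the essential index. For
  \<open>x \<noteq> y\<close>, a feasible path from \<open>m x\<close> to \<open>y\<close> is
  \<open>m x, x\<close> followed by a feasible path from some other neighbour \<open>z\<close> of
  \<open>x\<close>, which changes the sign. Hence the sum of \<open>F z y\<close> over all neighbours
  \<open>z\<close> of \<open>x\<close> is \<open>1\<close> if \<open>x = y\<close> and \<open>0\<close> otherwise, that is,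
  \<open>F\<close> is the inverse of the adjacency matrix.\<close>

section \<open>Elementary facts about graphs\<close>

lemma adjacent_sym: "adjacent G u v \<longleftrightarrow> adjacent G v u"
  by (simp add: adjacent_def insert_commute)

lemma adjacent_verts:
  assumes "finite_simple_graph G" "adjacent G u v"
  shows "u \<in> verts G" "v \<in> verts G" "u \<noteq> v"
  using assms by (auto simp: finite_simple_graph_def adjacent_def card_insert_if split: if_splits)

lemma verts_delete_verts [simp]: "verts (delete_verts G S) = verts G - S"
  by (auto simp: delete_verts_def induced_subgraph_def)

lemma edges_delete_verts [simp]:
  "edges (delete_verts G S) = {e \<in> edges G. e \<subseteq> verts G - S}"
  by (auto simp: delete_verts_def induced_subgraph_def)

lemma finite_simple_graph_delete_verts:
  "finite_simple_graph G \<Longrightarrow> finite_simple_graph (delete_verts G S)"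
  by (auto simp: finite_simple_graph_def)

lemma degree_one_neighbour:
  assumes "vertex_degree G v = 1" "adjacent G u v" "adjacent G w v"
  shows "w = u"
proof -
  obtain e where e: "{e \<in> edges G. v \<in> e} = {e}"
    using assms(1) unfolding vertex_degree_def by (rule card_1_singletonE)
  have unique: "e' = e" if "e' \<in> edges G" "v \<in> e'" for e'
  proof -
    have "e' \<in> {e \<in> edges G. v \<in> e}" using that by simp
    then show ?thesis unfolding e by simp
  qed
  have "{w, v} = {u, v}"
    using unique[of "{w, v}"] unique[of "{u, v}"] assms(2,3) by (simp add: adjacent_def)
  then show ?thesis by (auto simp: doubleton_eq_iff)
qed

section \<open>From reductions to a ranked matching\<close>

text \<open>The function \<open>\<sigma>\<close> distinguishes the two colour classes by a sign. Contracting the edges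
  of a perfect matching of a bipartite graph and orienting the others from one colour class to the
  other gives a digraph; \<open>r\<close> is a topological ordering of it. The sign makes the
  condition symmetric in the two classes.\<close>

locale ranked_matching =
  fixes G :: "'a ugraph" and \<sigma> r :: "'a \<Rightarrow> int" and m :: "'a \<Rightarrow> 'a"
  assumes graph: "finite_simple_graph G"
    and sign: "\<And>v. \<sigma> v = 1 \<or> \<sigma> v = - 1"
    and sign_adj: "\<And>u v. adjacent G u v \<Longrightarrow> \<sigma> v = - \<sigma> u"
    and mate: "\<And>v. v \<in> verts G \<Longrightarrow> adjacent G v (m v)"
    and mate_mate: "\<And>v. v \<in> verts G \<Longrightarrow> m (m v) = v"
    and rank_mate: "\<And>v. v \<in> verts G \<Longrightarrow> r (m v) = r v"
    and rank: "\<And>u v. adjacent G u v \<Longrightarrow> v \<noteq> m u \<Longrightarrow> \<sigma> u * r v < \<sigma> u * r u"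

text \<open>The reductions are undone one at a time: the deleted edge \<open>uv\<close> joins the
  matching of the smaller graph, and both its ends get a common new rank \<open>c\<close>. The
  colouring \<sigma> stays fixed. At \<open>v\<close> the rank condition is vacuous, because the
  only neighbour of \<open>v\<close> is its partner \<open>u\<close>.\<close>

lemma K2_reducible_ranked:
  assumes "K2_reducible G" "finite_simple_graph G" "\<And>v. \<sigma> v = 1 \<or> \<sigma> v = - (1::int)"
    and "\<And>u v. adjacent G u v \<Longrightarrow> \<sigma> v = - \<sigma> u"
  shows "\<exists>m r. ranked_matching G \<sigma> r m"
  using assms(1)[unfolded K2_reducible_def] assms(2,4)
proof (induction rule: converse_rtranclp_induct)
  case base
  show ?case
    by (intro exI[of _ id] exI[of _ "\<lambda>_. 0"] ranked_matching.intro)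
       (use assms(3) in \<open>auto simp: finite_simple_graph_def adjacent_def\<close>)
next
  case (step G G')
  from step.hyps(1) obtain u v where v: "v \<in> verts G" "vertex_degree G v = 1"
    and uv: "adjacent G u v" and G': "G' = delete_verts G {u, v}"
    by (auto elim: K2_reduction.cases)
  have adj': "adjacent G' a b \<longleftrightarrow> adjacent G a b \<and> {a, b} \<inter> {u, v} = {}" for a b
    using adjacent_verts[OF step.prems(1), of a b] by (auto simp: G' adjacent_def)
  have "\<exists>m r. ranked_matching G' \<sigma> r m"
  proof (rule step.IH)
    show "finite_simple_graph G'"
      using finite_simple_graph_delete_verts[OF step.prems(1)] by (simp add: G')
  qed (use step.prems(2) adj' in blast)
  then obtain m r where "ranked_matching G' \<sigma> r m" by blast
  then interpret R: ranked_matching G' \<sigma> r m .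
  have fin: "finite (verts G)" using step.prems(1) by (simp add: finite_simple_graph_def)
  note uvV = adjacent_verts[OF step.prems(1) uv]
  have only: "w = u" if "adjacent G w v" for w
    using degree_one_neighbour[OF v(2) uv that] .
  \<comment> \<open>An extreme value: \<open>\<sigma> u * c\<close> exceeds every
    \<open>\<sigma> u * r w\<close>. This gives the rank condition for the edges leaving
    \<open>u\<close>, and also for those entering it, where the opposite sign reverses the
    inequality.\<close>
  define c where "c = \<sigma> u * (1 + (\<Sum>w\<in>verts G. \<bar>r w\<bar>))"
  have c: "\<sigma> u * r w < \<sigma> u * c" if "w \<in> verts G" for w
  proof -
    have "\<bar>r w\<bar> \<le> (\<Sum>w\<in>verts G. \<bar>r w\<bar>)"
      using fin that by (intro member_le_sum) auto
    then show ?thesis using assms(3)[of u] by (auto simp: c_def)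
  qed
  define m' where "m' = m(u := v, v := u)"
  define r' where "r' = r(u := c, v := c)"
  have mV: "m w \<in> verts G - {u, v}" if "w \<in> verts G - {u, v}" for w
    using adjacent_verts(2)[OF R.graph R.mate, of w] that by (simp add: G')
  have "ranked_matching G \<sigma> r' m'"
  proof (rule ranked_matching.intro)
    fix w assume w: "w \<in> verts G"
    show "adjacent G w (m' w)"
      using R.mate[of w] w uv uvV unfolding adj' by (auto simp: m'_def G' adjacent_sym[of G v])
    show "m' (m' w) = w"
      using R.mate_mate[of w] mV[of w] w uvV by (auto simp: m'_def G')
    show "r' (m' w) = r' w"
      using R.rank_mate[of w] mV[of w] w uvV by (auto simp: m'_def r'_def G')
  next
    fix a b assume ab: "adjacent G a b" "b \<noteq> m' a"
    note abV = adjacent_verts[OF step.prems(1) ab(1)]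
    have "a \<noteq> v" using ab only[of b] uvV by (auto simp: adjacent_sym m'_def)
    moreover have "b \<noteq> v" using ab only[of a] uvV by (auto simp: m'_def)
    moreover have "\<sigma> a * c < \<sigma> a * r a" if "b = u"
      using c[OF abV(1)] step.prems(2)[OF ab(1)] that by simp
    ultimately show "\<sigma> a * r' b < \<sigma> a * r' a"
      using ab abV c[OF abV(2)] R.rank[of a b]
      by (auto simp: m'_def r'_def adj')
  qed (use step.prems assms(3) in auto)
  then show ?case by blast
qed

section \<open>Colour parity, and perfect 2-matchings as permutations\<close>

text \<open>Every term is odd. Hence a set whose colours cancel has even size, which will show that
  feasible paths have an even number of vertices.\<close>

lemma even_sum_signs:
  fixes \<sigma> :: "'a \<Rightarrow> int"
  assumes "\<And>v. \<sigma> v = 1 \<or> \<sigma> v = - 1" "finite S"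
  shows "even (sum \<sigma> S) \<longleftrightarrow> even (card S)"
  using assms(2)
proof (induction S)
  case (insert v S)
  then show ?case using assms(1)[of v] by auto
qed simp

lemma reach_sym:
  assumes "(adjacent H)\<^sup>*\<^sup>* v w"
  shows "(adjacent H)\<^sup>*\<^sup>* w v"
  using assms by (metis (no_types) adjacent_sym symp_rtranclp sympI sympD)

lemma component_of_eq:
  assumes "(adjacent H)\<^sup>*\<^sup>* v w"
  shows "component_of H w = component_of H v"
proof -
  have "{u. (adjacent H)\<^sup>*\<^sup>* v u} = {u. (adjacent H)\<^sup>*\<^sup>* w u}"
    using assms reach_sym[OF assms] by (auto intro: rtranclp_trans)
  then show ?thesis by (simp add: component_of_def)
qed

text \<open>A cycle is rotated by one step; the ends of a single edge are swapped.\<close>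

lemma cycle_or_edge_permutation:
  assumes "is_cycle_graph C \<or> is_single_edge_graph C"
  shows "\<exists>h. inj_on h (verts C) \<and> (\<forall>v\<in>verts C. h v \<in> verts C \<and> {v, h v} \<in> edges C)"
  using assms
proof
  assume "is_cycle_graph C"
  then obtain vs where vs: "3 \<le> length vs" "distinct vs" "verts C = set vs"
    "edges C = {{vs ! i, vs ! (Suc i mod length vs)} | i. i < length vs}"
    by (auto simp: is_cycle_graph_def)
  define idx where "idx v = (THE i. i < length vs \<and> vs ! i = v)" for v
  have idx: "idx (vs ! i) = i" if "i < length vs" for i
    unfolding idx_def using that vs(2) by (auto intro!: the_equality simp: nth_eq_iff_index_eq)
  let ?h = "\<lambda>v. vs ! (Suc (idx v) mod length vs)"
  have "inj_on ?h (verts C)"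
  proof (rule inj_onI)
    fix a b assume ab: "a \<in> verts C" "b \<in> verts C" "?h a = ?h b"
    then obtain i j where ij: "i < length vs" "a = vs ! i" "j < length vs" "b = vs ! j"
      using vs(3) by (auto simp: in_set_conv_nth)
    have "length vs > 0" using ij by linarith
    then have "Suc i mod length vs = Suc j mod length vs"
      using ab(3) ij vs(2) by (simp add: idx nth_eq_iff_index_eq)
    then have "i = j"
      using ij by (auto simp: mod_Suc split: if_splits)
    then show "a = b" using ij by simp
  qed
  moreover have "?h v \<in> verts C \<and> {v, ?h v} \<in> edges C" if v: "v \<in> verts C" for v
  proof -
    obtain i where i: "i < length vs" "v = vs ! i"
      using v vs(3) by (auto simp: in_set_conv_nth)
    then have "Suc i mod length vs < length vs" by (intro mod_less_divisor) linarith
    then show ?thesis using i vs(3,4) idx[OF i(1)] by auto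
  qed
  ultimately show ?thesis by blast
next
  assume "is_single_edge_graph C"
  then obtain u v where uv: "u \<noteq> v" "verts C = {u, v}" "edges C = {{u, v}}"
    by (auto simp: is_single_edge_graph_def)
  let ?h = "id(u := v, v := u)"
  have "inj_on ?h (verts C)" using uv by (auto simp: inj_on_def)
  moreover have "?h w \<in> verts C \<and> {w, ?h w} \<in> edges C" if "w \<in> verts C" for w
    using uv that by auto
  ultimately show ?thesis by blast
qed

text \<open>The permutations of the components are glued. Each preserves its component, so equal
  values come from the same component. From here on, cycles and single edges need no separate
  treatment.\<close>

lemma perfect_2_matching_permutation:
  assumes "perfect_2_matching G H"
  shows "\<exists>h. inj_on h (verts G) \<and> (\<forall>v\<in>verts G. h v \<in> verts G \<and> adjacent G v (h v))"
proof -
  have VH: "verts H = verts G" and EH: "edges H \<subseteq> edges G"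
    using assms by (auto simp: perfect_2_matching_def spanning_subgraph_def)
  have "\<forall>C\<in>graph_components H. \<exists>h. inj_on h (verts C) \<and>
      (\<forall>v\<in>verts C. h v \<in> verts C \<and> {v, h v} \<in> edges C)"
    using assms cycle_or_edge_permutation by (auto simp: perfect_2_matching_def)
  then obtain k where k: "\<And>C. C \<in> graph_components H \<Longrightarrow> inj_on (k C) (verts C)"
    "\<And>C v. C \<in> graph_components H \<Longrightarrow> v \<in> verts C \<Longrightarrow> k C v \<in> verts C \<and> {v, k C v} \<in> edges C"
    by metis
  let ?C = "component_of H"
  have C: "?C v \<in> graph_components H" "v \<in> verts (?C v)" if "v \<in> verts G" for v
    using that by (auto simp: graph_components_def component_of_def induced_subgraph_def VH)
  have same: "w \<in> verts G" "?C w = ?C v" if "w \<in> verts (?C v)" for v w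
    using that component_of_eq[of H v w]
    by (auto simp: component_of_def induced_subgraph_def VH)
  have EC: "edges (?C v) \<subseteq> edges G" for v
    using EH by (auto simp: component_of_def induced_subgraph_def)
  let ?h = "\<lambda>v. k (?C v) v"
  have h: "?h v \<in> verts (?C v)" "{v, ?h v} \<in> edges (?C v)" if "v \<in> verts G" for v
    using k(2)[OF C[OF that]] by auto
  have "inj_on ?h (verts G)"
  proof (rule inj_onI)
    fix a b assume ab: "a \<in> verts G" "b \<in> verts G" "?h a = ?h b"
    have "?C a = ?C b"
      using same(2)[OF h(1)[OF ab(1)]] same(2)[OF h(1)[OF ab(2)]] ab(3) by simp
    then show "a = b"
      using k(1)[OF C(1)[OF ab(1)]] C(2)[OF ab(1)] C(2)[OF ab(2)] ab(3)
      by (simp add: inj_on_def)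
  qed
  moreover have "?h v \<in> verts G \<and> adjacent G v (?h v)" if "v \<in> verts G" for v
    using same(1)[OF h(1)[OF that]] h(2)[OF that] EC by (auto simp: adjacent_def)
  ultimately show ?thesis by blast
qed

section \<open>Alternating vertex lists and path edges\<close>

text \<open>Vertices are consumed in pairs, so a nonempty alternating path begins and ends with a
  matching edge. The empty list is only the base of the recursion; \<open>is_path\<close> excludes
  it.\<close>

fun alternating :: "('a \<Rightarrow> 'a) \<Rightarrow> 'a list \<Rightarrow> bool" where
  "alternating m [] \<longleftrightarrow> True"
| "alternating m [a] \<longleftrightarrow> False"
| "alternating m (a # b # p) \<longleftrightarrow> b = m a \<and> alternating m p"

lemma alternating_nth:
  "alternating m p \<longleftrightarrow>
     even (length p) \<and> (\<forall>i. Suc i < length p \<longrightarrow> even i \<longrightarrow> p ! Suc i = m (p ! i))"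
proof (induction m p rule: alternating.induct)
  case (3 m a b p)
  have iff: "(\<forall>i. Suc i < length (a # b # p) \<longrightarrow> even i \<longrightarrow> (a # b # p) ! Suc i = m ((a # b # p) ! i))
    \<longleftrightarrow> b = m a \<and> (\<forall>i. Suc i < length p \<longrightarrow> even i \<longrightarrow> p ! Suc i = m (p ! i))" (is "?L \<longleftrightarrow> ?R")
  proof
    assume L: ?L
    have "p ! Suc i = m (p ! i)" if "Suc i < length p" "even i" for i
      using L[rule_format, of "Suc (Suc i)"] that by simp
    then show ?R using L[rule_format, of 0] by simp
  next
    assume R: ?R
    show ?L
    proof (intro allI impI)
      fix i assume "Suc i < length (a # b # p)" "even i"
      then show "(a # b # p) ! Suc i = m ((a # b # p) ! i)"
        using R by (cases i; cases "i - Suc 0") auto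
    qed
  qed
  have len: "even (length (a # b # p)) \<longleftrightarrow> even (length p)" by simp
  show ?case unfolding alternating.simps 3 iff len by blast
qed auto

lemma path_edges_Cons2:
  "path_edges (a # b # p) = insert {a, b} (path_edges (b # p))"
proof -
  have "{(a # b # p) ! i, (a # b # p) ! Suc i} \<in> insert {a, b} (path_edges (b # p))"
    if "Suc i < length (a # b # p)" for i
    using that by (cases i) (auto simp: path_edges_def)
  moreover have "{(b # p) ! i, (b # p) ! Suc i} \<in> path_edges (a # b # p)"
    if "Suc i < length (b # p)" for i
    using that by (auto simp: path_edges_def intro!: exI[of _ "Suc i"])
  moreover have "{a, b} \<in> path_edges (a # b # p)"
    by (auto simp: path_edges_def intro!: exI[of _ 0])
  ultimately show ?thesis
    by (auto simp: path_edges_def[of "a # b # p"] path_edges_def[of "b # p"])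
qed

lemma path_edges_singleton: "path_edges [a] = {}"
  by (simp add: path_edges_def)

lemma path_edges_subset: "e \<in> path_edges p \<Longrightarrow> e \<subseteq> set p"
  by (auto simp: path_edges_def)

lemma finite_path_edges: "finite (path_edges p)"
  by (rule finite_subset[of _ "Pow (set p)"]) (use path_edges_subset in auto)

section \<open>Uniqueness of the perfect matching\<close>

context ranked_matching
begin

abbreviation "V \<equiv> verts G"

abbreviation "M \<equiv> (\<lambda>v. {v, m v}) ` V"

lemma finite_V: "finite V"
  using graph by (simp add: finite_simple_graph_def)

lemma mate_V: "v \<in> V \<Longrightarrow> m v \<in> V"
  using adjacent_verts(2)[OF graph mate] .

lemma mate_neq: "v \<in> V \<Longrightarrow> m v \<noteq> v"
  using adjacent_verts(3)[OF graph mate] by metis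

text \<open>An injective self-map of a finite set permutes it, so the sum may be reindexed by
  \<open>n\<close>; every edge from \<open>v\<close> to \<open>n v\<close> flips the sign.\<close>

lemma sum_permutation:
  fixes f :: "'a \<Rightarrow> int"
  assumes "finite W" "inj_on n W" "\<And>v. v \<in> W \<Longrightarrow> n v \<in> W \<and> adjacent G v (n v)"
  shows "(\<Sum>v\<in>W. \<sigma> v * f (n v)) = - (\<Sum>v\<in>W. \<sigma> v * f v)"
proof -
  have "n ` W = W"
    using assms by (intro endo_inj_surj) auto
  then have "(\<Sum>v\<in>W. \<sigma> v * f v) = (\<Sum>v\<in>W. \<sigma> (n v) * f (n v))"
    using sum.reindex[OF assms(2), of "\<lambda>v. \<sigma> v * f v"] by simp
  also have "\<dots> = (\<Sum>v\<in>W. - (\<sigma> v * f (n v)))"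
    using sign_adj[OF conjunct2[OF assms(3)]] by (intro sum.cong) auto
  finally show ?thesis by (simp add: sum_negf)
qed

text \<open>For the constant function 1 the sum is its own negative.\<close>

lemma sum_sign_permutation:
  assumes "finite W" "inj_on n W" "\<And>v. v \<in> W \<Longrightarrow> n v \<in> W \<and> adjacent G v (n v)"
  shows "sum \<sigma> W = 0"
  using sum_permutation[OF assms, of "\<lambda>_. 1"] by simp

lemma inj_on_mate: "inj_on m V"
  using mate_mate by (metis inj_onI)

text \<open>Summing the rank inequality over all vertices gives an equality, so that it is never strict.\<close>

lemma permutation_eq_mate:
  assumes n: "inj_on n V" "\<And>v. v \<in> V \<Longrightarrow> n v \<in> V \<and> adjacent G v (n v)" and v: "v \<in> V"
  shows "n v = m v"
proof (rule ccontr)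
  assume neq: "n v \<noteq> m v"
  have le: "\<sigma> w * r (n w) \<le> \<sigma> w * r w" if "w \<in> V" for w
    using rank[of w "n w"] rank_mate[OF that] n(2)[OF that] by (cases "n w = m w") auto
  have "(\<Sum>w\<in>V. \<sigma> w * r (n w)) < (\<Sum>w\<in>V. \<sigma> w * r w)"
    using finite_V le rank[of v "n v"] n(2)[OF v] neq v by (intro sum_strict_mono_ex1) auto
  moreover have "(\<Sum>w\<in>V. \<sigma> w * r (n w)) = - (\<Sum>w\<in>V. \<sigma> w * r w)"
    by (rule sum_permutation[OF finite_V n])
  \<comment> \<open>The sum along \<open>m\<close> is computed twice, by reindexing and by
    \<open>rank_mate\<close>. So the sum of \<open>\<sigma> w * r w\<close> is its own negative,
    hence 0, and the strict inequality becomes 0 < 0.\<close>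
  moreover have "(\<Sum>w\<in>V. \<sigma> w * r (m w)) = - (\<Sum>w\<in>V. \<sigma> w * r w)"
    by (rule sum_permutation[OF finite_V inj_on_mate]) (simp add: mate_V mate)
  moreover have "(\<Sum>w\<in>V. \<sigma> w * r (m w)) = (\<Sum>w\<in>V. \<sigma> w * r w)"
    by (intro sum.cong) (auto simp: rank_mate)
  ultimately show False by linarith
qed

lemma edge_in_M_iff:
  assumes "a \<in> V"
  shows "{a, b} \<in> M \<longleftrightarrow> b = m a"
proof
  assume "{a, b} \<in> M"
  then obtain v where "v \<in> V" "{a, b} = {v, m v}" by auto
  then show "b = m a" using mate_mate by (auto simp: doubleton_eq_iff)
qed (use assms in auto)

lemma perfect_matching_M: "perfect_matching G M"
proof -
  have "\<exists>!e. e \<in> M \<and> v \<in> e" if v: "v \<in> V" for v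
  proof (rule ex1I[of _ "{v, m v}"])
    show "{v, m v} \<in> M \<and> v \<in> {v, m v}" using v by auto
  next
    fix e assume "e \<in> M \<and> v \<in> e"
    then show "e = {v, m v}" using mate_mate by auto
  qed
  then show ?thesis
    using mate by (auto simp: perfect_matching_def adjacent_def)
qed

text \<open>Sending each vertex to its partner in \<open>N\<close> permutes the vertices along
  edges, and \<open>m\<close> is the only such permutation.\<close>

lemma perfect_matching_eq_M:
  assumes "perfect_matching G N"
  shows "N = M"
proof -
  have NE: "N \<subseteq> edges G" and ex1: "\<And>v. v \<in> V \<Longrightarrow> \<exists>!e. e \<in> N \<and> v \<in> e"
    using assms by (auto simp: perfect_matching_def)
  have "\<exists>w. {v, w} \<in> N" if v: "v \<in> V" for v
  proof -
    obtain e where e: "e \<in> N" "v \<in> e" using ex1[OF v] by blast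
    then have "card e = 2" using NE graph by (auto simp: finite_simple_graph_def)
    then obtain a b where "e = {a, b}" by (auto simp: card_2_iff)
    then have "e = {v, if v = a then b else a}" using e(2) by auto
    then show ?thesis using e(1) by metis
  qed
  then obtain n where n: "\<And>v. v \<in> V \<Longrightarrow> {v, n v} \<in> N" by metis
  have adj: "adjacent G v (n v)" if "v \<in> V" for v
    using n[OF that] NE by (auto simp: adjacent_def)
  have nV: "n v \<in> V" if "v \<in> V" for v
    using adjacent_verts(2)[OF graph adj[OF that]] .
  have "inj_on n V"
  proof (rule inj_onI)
    fix a b assume ab: "a \<in> V" "b \<in> V" "n a = n b"
    have "{a, n a} = {b, n b}"
      using ex1[OF nV[OF ab(1)]] n[OF ab(1)] n[OF ab(2)] ab(3) by blast
    then show "a = b" using ab(3) by (auto simp: doubleton_eq_iff)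
  qed
  then have nm: "n v = m v" if "v \<in> V" for v
    using permutation_eq_mate[of n] nV adj that by blast
  then have "M \<subseteq> N" using n by auto
  moreover have "e \<in> M" if e: "e \<in> N" for e
  proof -
    have "e \<subseteq> V" "card e = 2" using e NE graph by (auto simp: finite_simple_graph_def)
    then obtain v where v: "v \<in> e" "v \<in> V" by (auto simp: card_2_iff)
    then have "e = {v, m v}" using ex1[OF v(2)] n[OF v(2)] nm[OF v(2)] e by auto
    then show ?thesis using v(2) by auto
  qed
  ultimately show ?thesis by blast
qed

lemma unique_matching_eq: "unique_matching G = M"
  unfolding unique_matching_def
  using perfect_matching_M perfect_matching_eq_M by (intro the_equality)

section \<open>Feasible paths are the alternating paths\<close>

lemma alternating_closed:
  assumes "alternating m p" "set p \<subseteq> V"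
  shows "v \<in> set p \<Longrightarrow> m v \<in> set p"
  using assms by (induction p rule: induct_list012) (auto simp: mate_mate)

text \<open>If \<open>S\<close> is closed under \<open>m\<close>, so is its complement, and the
  remaining matching edges are the components. This makes alternating paths feasible.\<close>

lemma mates_perfect_2_matching:
  assumes "\<And>v. v \<in> S \<Longrightarrow> m v \<in> S" "S \<subseteq> V"
  shows "perfect_2_matching (delete_verts G S) (Graph (V - S) ((\<lambda>v. {v, m v}) ` (V - S)))"
    (is "perfect_2_matching ?G' ?H")
proof -
  have closed: "m v \<in> V - S" if "v \<in> V - S" for v
    using assms mate_V[of v] mate_mate[of v] that by (metis DiffD1 DiffD2 DiffI)
  have adjH: "adjacent ?H a b \<longleftrightarrow> a \<in> V - S \<and> b = m a" for a b
    using closed mate_mate by (auto simp: adjacent_def doubleton_eq_iff image_iff)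
  have "is_single_edge_graph (component_of ?H v)" if v: "v \<in> V - S" for v
  proof -
    have "w \<in> {v, m v}" if "(adjacent ?H)\<^sup>*\<^sup>* v w" for w
      using that by induction (use v mate_mate in \<open>auto simp: adjH\<close>)
    moreover have "(adjacent ?H)\<^sup>*\<^sup>* v (m v)" using v by (auto simp: adjH)
    ultimately have reach: "{w. (adjacent ?H)\<^sup>*\<^sup>* v w} = {v, m v}" by auto
    have "{e \<in> edges ?H. e \<subseteq> {v, m v}} = {{v, m v}}"
      using v mate_mate by auto
    moreover have "verts ?H \<inter> {v, m v} = {v, m v}" using v closed[OF v] by auto
    ultimately have "component_of ?H v = Graph {v, m v} {{v, m v}}"
      unfolding component_of_def reach induced_subgraph_def by (simp only:)
    then show ?thesis using mate_neq[of v] v by (auto simp: is_single_edge_graph_def)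
  qed
  moreover have "spanning_subgraph ?H ?G'"
    using closed mate by (auto simp: spanning_subgraph_def adjacent_def)
  ultimately show ?thesis
    by (auto simp: perfect_2_matching_def graph_components_def)
qed

text \<open>Pairing consecutive vertices of the path and permuting the rest along its 2-matching
  gives a permutation of all vertices along edges. It must be \<open>m\<close>, so the pairs on the
  path are matching edges.\<close>

lemma feasible_alternating:
  assumes p: "is_path G x y p" and H: "perfect_2_matching (delete_verts G (set p)) H"
  shows "alternating m p"
proof -
  have dist: "distinct p" and pV: "set p \<subseteq> V" and adj: "successively (adjacent G) p"
    using p by (auto simp: is_path_def)
  obtain h where h: "inj_on h (V - set p)"
    "\<And>v. v \<in> V - set p \<Longrightarrow> h v \<in> V - set p \<and> adjacent G v (h v)"
    using perfect_2_matching_permutation[OF H] by (auto simp: adjacent_def)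
  \<comment> \<open>The colours cancel on the whole graph and off the path, hence on the path, which
    therefore has an even number of vertices.\<close>
  have "sum \<sigma> V = 0"
    using mate mate_V by (intro sum_sign_permutation[OF finite_V inj_on_mate]) auto
  moreover have "sum \<sigma> (V - set p) = 0"
    using finite_V h by (intro sum_sign_permutation[of _ h]) auto
  ultimately have "sum \<sigma> (set p) = 0"
    using sum.subset_diff[OF pV finite_V, of \<sigma>] by simp
  then have len: "even (length p)"
    using even_sum_signs[of \<sigma> "set p"] sign distinct_card[OF dist] by simp
  define idx where "idx v = (THE i. i < length p \<and> p ! i = v)" for v
  have idx: "idx (p ! i) = i" if "i < length p" for i
    unfolding idx_def using that dist by (auto intro!: the_equality simp: nth_eq_iff_index_eq)
  \<comment> \<open>Swaps positions \<open>2k\<close> and \<open>2k + 1\<close>; the even length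
    keeps the last even position from lacking a partner.\<close>
  define sw where "sw i = (if even i then Suc i else i - 1)" for i :: nat
  have sw: "sw i < length p" "sw (sw i) = i" "adjacent G (p ! i) (p ! sw i)"
    if i: "i < length p" for i
  proof -
    have suc: "adjacent G (p ! j) (p ! Suc j)" if "Suc j < length p" for j
      using adj that by (simp add: successively_conv_nth)
    have "sw i < length p \<and> sw (sw i) = i \<and> adjacent G (p ! i) (p ! sw i)"
    proof (cases "even i")
      case True
      then have "Suc i < length p" using i len by (metis Suc_lessI even_Suc)
      then show ?thesis using True suc[of i] by (simp add: sw_def)
    next
      case False
      then obtain j where "i = Suc j" "even j" by (cases i) auto
      then show ?thesis using i suc[of j] by (simp add: sw_def adjacent_sym)
    qed
    then show "sw i < length p" "sw (sw i) = i" "adjacent G (p ! i) (p ! sw i)"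
      by blast+
  qed
  define n where "n v = (if v \<in> set p then p ! sw (idx v) else h v)" for v
  have n: "n v \<in> set p \<and> n (n v) = v \<and> adjacent G v (n v)" if v: "v \<in> set p" for v
  proof -
    obtain i where "i < length p" "v = p ! i" using v by (auto simp: in_set_conv_nth)
    then show ?thesis using sw[of i] by (simp add: n_def idx)
  qed
  have "inj_on n V"
  proof (rule inj_onI)
    fix a b assume ab: "a \<in> V" "b \<in> V" "n a = n b"
    show "a = b"
    proof (cases "a \<in> set p")
      case True
      then have "n b \<in> set p" using n[of a] ab(3) by simp
      then have "b \<in> set p" using h(2)[of b] ab(2) by (cases "b \<in> set p") (auto simp: n_def)
      then show ?thesis using n[of a] n[of b] True ab(3) by metis
    next
      case False
      then have "n b \<notin> set p" using h(2)[of a] ab(1,3) by (auto simp: n_def)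
      then have "b \<notin> set p" using n[of b] by blast
      then show ?thesis using h(1) False ab by (auto simp: n_def inj_on_def)
    qed
  qed
  moreover have "n v \<in> V \<and> adjacent G v (n v)" if "v \<in> V" for v
    using n[of v] h(2)[of v] pV that by (cases "v \<in> set p") (auto simp: n_def)
  ultimately have nm: "n v = m v" if "v \<in> V" for v
    using permutation_eq_mate that by blast
  have "p ! Suc i = m (p ! i)" if i: "Suc i < length p" "even i" for i
  proof -
    have "p ! i \<in> set p" using i by simp
    then have "p ! i \<in> V" using pV by blast
    then show ?thesis using nm[of "p ! i"] i by (auto simp: n_def idx sw_def)
  qed
  then show ?thesis using len by (simp add: alternating_nth)
qed

definition alternating_paths :: "'a \<Rightarrow> 'a \<Rightarrow> 'a list set" where
  "alternating_paths x y = {p. is_path G x y p \<and> alternating m p}"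

lemma feasible_path_iff: "feasible_path G x y p \<longleftrightarrow> p \<in> alternating_paths x y"
proof
  assume p: "p \<in> alternating_paths x y"
  then have "set p \<subseteq> V" "alternating m p" by (auto simp: alternating_paths_def is_path_def)
  then show "feasible_path G x y p"
    using p mates_perfect_2_matching[of "set p"] alternating_closed[of p]
    by (auto simp: feasible_path_def alternating_paths_def)
qed (auto simp: feasible_path_def alternating_paths_def feasible_alternating)

lemma finite_alternating_paths: "finite (alternating_paths x y)"
  by (rule finite_subset[OF _ finite_subset_distinct[OF finite_V]])
     (auto simp: alternating_paths_def is_path_def)

section \<open>Signed path counts\<close>

definition path_sign :: "'a list \<Rightarrow> int" where
  "path_sign p = (- 1) ^ card (path_edges p - M)"

definition signed_count :: "'a \<Rightarrow> 'a \<Rightarrow> int" where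
  "signed_count x y = (\<Sum>p\<in>alternating_paths x y. path_sign p)"

lemma essential_index_eq: "essential_index G x y = \<bar>signed_count x y\<bar>"
proof -
  let ?odd = "{p \<in> alternating_paths x y. odd (card (path_edges p - M))}"
  let ?even = "{p \<in> alternating_paths x y. even (card (path_edges p - M))}"
  have "alternating_paths x y = ?odd \<union> ?even" by auto
  then have "signed_count x y = (\<Sum>p\<in>?odd \<union> ?even. path_sign p)"
    by (simp add: signed_count_def)
  also have "\<dots> = sum path_sign ?odd + sum path_sign ?even"
    using finite_alternating_paths by (intro sum.union_disjoint) auto
  also have "\<dots> = (\<Sum>p\<in>?odd. - 1) + (\<Sum>p\<in>?even. 1)"
    by (intro arg_cong2[where f = "(+)"] sum.cong) (auto simp: path_sign_def)
  also have "\<dots> = int (tau_even G x y) - int (tau_odd G x y)"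
    by (simp add: tau_even_def tau_odd_def feasible_path_iff unique_matching_eq)
  finally show ?thesis by (simp add: essential_index_def)
qed

section \<open>The recursion for signed counts\<close>

text \<open>The rank is monotone along an alternating path, since only its edges outside the matching
  change the rank.\<close>

lemma alternating_rank:
  assumes "alternating m p" "successively (adjacent G) p" "distinct p" "set p \<subseteq> V" "v \<in> set p"
  shows "\<sigma> (hd p) * r (hd p) \<le> \<sigma> (hd p) * r v"
  using assms
proof (induction p rule: induct_list012)
  case (3 a b q)
  have a: "a \<in> V" and b: "b = m a" "b \<in> V" using 3 by auto
  show ?case
  proof (cases "v \<in> set q")
    case True
    then obtain c q' where q: "q = c # q'" by (cases q) auto
    \<comment> \<open>The edge \<open>bc\<close> lies outside the matching because \<open>c\<close>
      differs from \<open>a\<close>, the partner of \<open>b\<close>. As \<open>c\<close> has the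
      colour of \<open>a\<close>, its strict inequality chains with the induction hypothesis for
      \<open>q\<close>.\<close>
    have bc: "adjacent G b c" "c \<noteq> a" using 3 q by auto
    have "\<sigma> b * r c < \<sigma> b * r b"
      using rank[OF bc(1)] bc(2) b(1) mate_mate[OF a] by simp
    moreover have "\<sigma> b = - \<sigma> a" "\<sigma> c = - \<sigma> b"
      using sign_adj mate[OF a] bc(1) b(1) by auto
    moreover have "\<sigma> c * r c \<le> \<sigma> c * r v" using 3 True q by simp
    ultimately show ?thesis using rank_mate[OF a] b(1) by simp
  next
    case False
    then show ?thesis using 3 rank_mate[OF a] by auto
  qed
qed auto

text \<open>A path meeting \<open>x\<close> could be closed by the edge \<open>xz\<close> to an alternating cycle.\<close>

lemma alternating_path_avoids:
  assumes "adjacent G x z" "z \<noteq> m x" "q \<in> alternating_paths z y"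
  shows "x \<notin> set q" "m x \<notin> set q"
proof -
  have x: "x \<in> V" using adjacent_verts(1)[OF graph assms(1)] .
  have q: "hd q = z" "alternating m q" "successively (adjacent G) q" "distinct q" "set q \<subseteq> V"
    using assms(3) by (auto simp: alternating_paths_def is_path_def)
  \<comment> \<open>Along \<open>q\<close> the value \<open>\<sigma> z * r v\<close> never drops
    below its start at \<open>z\<close>, whereas at \<open>x\<close> and \<open>m x\<close>, which
    share a rank, it is smaller.\<close>
  have "\<sigma> z * r x < \<sigma> z * r z"
    using rank[OF assms(1,2)] sign_adj[OF assms(1)] by simp
  then show "x \<notin> set q" "m x \<notin> set q"
    using alternating_rank[OF q(2-5)] q(1) rank_mate[OF x] by fastforce+
qed

text \<open>The first edge is forced to lead from \<open>m x\<close> to \<open>x\<close>; then the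
  path stops or goes on to another neighbour \<open>z\<close> of \<open>x\<close>. Conversely,
  prepending \<open>m x\<close> and \<open>x\<close> repeats no vertex by
  \<open>alternating_path_avoids\<close>.\<close>

lemma alternating_paths_mate:
  assumes x: "x \<in> V"
  shows "alternating_paths (m x) y =
    (if x = y then {[m x, x]} else {}) \<union>
    (\<lambda>q. m x # x # q) ` (\<Union>z\<in>{z. adjacent G x z \<and> z \<noteq> m x}. alternating_paths z y)"
    (is "?L = ?A \<union> ?B")
proof (intro equalityI subsetI)
  fix p assume "p \<in> ?L"
  then have p: "p \<noteq> []" "hd p = m x" "last p = y" "distinct p" "set p \<subseteq> V"
    "successively (adjacent G) p" "alternating m p"
    by (auto simp: alternating_paths_def is_path_def)
  obtain q where q: "p = m x # x # q"
    using p(1,2,7) mate_mate[OF x] by (cases "(m, p)" rule: alternating.cases) auto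
  show "p \<in> ?A \<union> ?B"
  proof (cases q)
    case Nil
    then show ?thesis using p q by simp
  next
    case (Cons z q')
    have "q \<in> alternating_paths z y" "adjacent G x z" "z \<noteq> m x"
      using p q Cons by (auto simp: alternating_paths_def is_path_def)
    then show ?thesis using q by blast
  qed
next
  fix p assume "p \<in> ?A \<union> ?B"
  then consider "x = y" "p = [m x, x]"
    | z q where "adjacent G x z" "z \<noteq> m x" "q \<in> alternating_paths z y" "p = m x # x # q"
    by (auto split: if_splits)
  then show "p \<in> ?L"
  proof cases
    case 1
    then show ?thesis
      using x mate[OF x] mate_V[OF x] mate_neq[OF x] mate_mate[OF x]
      by (auto simp: alternating_paths_def is_path_def adjacent_sym)
  next
    case (2 z q)
    then show ?thesis
      using x mate[OF x] mate_V[OF x] mate_neq[OF x] mate_mate[OF x]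
        alternating_path_avoids[OF 2(1-3)]
      by (auto simp: alternating_paths_def is_path_def adjacent_sym successively_Cons)
  qed
qed

text \<open>Of the two added edges only \<open>xz\<close> lies outside the matching, and it is new
  because \<open>q\<close> avoids \<open>x\<close>.\<close>

lemma path_sign_extend:
  assumes "adjacent G x z" "z \<noteq> m x" "q \<in> alternating_paths z y"
  shows "path_sign (m x # x # q) = - path_sign q"
proof -
  have x: "x \<in> V" using adjacent_verts(1)[OF graph assms(1)] .
  obtain q' where q: "q = z # q'"
    using assms(3) by (cases q) (auto simp: alternating_paths_def is_path_def)
  have "{m x, x} \<in> M" using x by (auto simp: insert_commute)
  moreover have "{x, z} \<notin> M" using edge_in_M_iff[OF x] assms(2) by simp
  ultimately have "path_edges (m x # x # q) - M = insert {x, z} (path_edges q - M)"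
    unfolding q path_edges_Cons2 by (simp add: insert_Diff_if)
  moreover have "{x, z} \<notin> path_edges q"
    using alternating_path_avoids(1)[OF assms] path_edges_subset by blast
  ultimately show ?thesis
    using finite_path_edges[of q] by (simp add: path_sign_def)
qed

lemma path_sign_edge:
  assumes "x \<in> V"
  shows "path_sign [m x, x] = 1"
proof -
  have "{m x, x} \<in> M" using assms by (auto simp: insert_commute)
  then have "path_edges [m x, x] - M = {}"
    unfolding path_edges_Cons2 path_edges_singleton by blast
  then show ?thesis unfolding path_sign_def by (simp only: card.empty power_0)
qed

text \<open>The decomposition of the paths is disjoint: \<open>[m x, x]\<close> has no nonempty
  rest, and the rests \<open>q\<close> for different \<open>z\<close> differ in their heads.\<close>

lemma signed_count_mate:
  assumes x: "x \<in> V"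
  shows "signed_count (m x) y =
    (if x = y then 1 else 0) - (\<Sum>z\<in>{z. adjacent G x z \<and> z \<noteq> m x}. signed_count z y)"
proof -
  let ?N = "{z. adjacent G x z \<and> z \<noteq> m x}"
  let ?U = "\<Union>z\<in>?N. alternating_paths z y"
  have "?N \<subseteq> V" using adjacent_verts(2)[OF graph] by auto
  then have fin: "finite ?N" using finite_V finite_subset by blast
  have hd: "p \<noteq> []" "hd p = z" if "p \<in> alternating_paths z y" for p z
    using that by (auto simp: alternating_paths_def is_path_def)
  have "signed_count (m x) y = sum path_sign (if x = y then {[m x, x]} else {})
      + sum path_sign ((\<lambda>q. m x # x # q) ` ?U)"
    unfolding signed_count_def alternating_paths_mate[OF x]
    using fin finite_alternating_paths hd by (intro sum.union_disjoint) auto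
  also have "sum path_sign (if x = y then {[m x, x]} else {}) = (if x = y then 1 else 0)"
    using path_sign_edge[OF x] by (cases "x = y") (simp_all del: One_nat_def)
  also have "sum path_sign ((\<lambda>q. m x # x # q) ` ?U) = (\<Sum>q\<in>?U. - path_sign q)"
    by (subst sum.reindex) (auto simp: inj_on_def path_sign_extend intro!: sum.cong)
  also have "\<dots> = (\<Sum>z\<in>?N. \<Sum>q\<in>alternating_paths z y. - path_sign q)"
  proof (intro sum.UNION_disjoint ballI impI)
    fix i j :: 'a
    assume "i \<noteq> j"
    then show "alternating_paths i y \<inter> alternating_paths j y = {}" using hd(2) by blast
  qed (use fin finite_alternating_paths in auto)
  finally show ?thesis by (simp add: sum_negf signed_count_def)
qed

text \<open>By the recursion, the term of the neighbour \<open>m x\<close> cancels those of all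
  other neighbours and leaves the Kronecker delta.\<close>

lemma sum_signed_count:
  assumes x: "x \<in> V"
  shows "(\<Sum>z\<in>{z. adjacent G x z}. signed_count z y) = (if x = y then 1 else 0)"
proof -
  have "{z. adjacent G x z} \<subseteq> V" using adjacent_verts(2)[OF graph] by auto
  then have "finite {z. adjacent G x z}" using finite_V finite_subset by blast
  then have "(\<Sum>z\<in>{z. adjacent G x z}. signed_count z y)
      = signed_count (m x) y + (\<Sum>z\<in>{z. adjacent G x z} - {m x}. signed_count z y)"
    using mate[OF x] by (intro sum.remove) auto
  moreover have "{z. adjacent G x z} - {m x} = {z. adjacent G x z \<and> z \<noteq> m x}" by auto
  ultimately show ?thesis by (simp add: signed_count_mate[OF x])
qed

section \<open>The inverse of the adjacency matrix\<close>

definition count_mat :: "'a list \<Rightarrow> real mat" where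
  "count_mat vs = mat (length vs) (length vs) (\<lambda>(i, j). of_int (signed_count (vs ! i) (vs ! j)))"

lemma adjacency_mat_inverse:
  assumes vs: "distinct vs" "set vs = V"
  shows "adjacency_mat G vs * count_mat vs = 1\<^sub>m (length vs)"
proof (rule eq_matI)
  fix i j assume "i < dim_row (1\<^sub>m (length vs))" "j < dim_col (1\<^sub>m (length vs))"
  then have ij: "i < length vs" "j < length vs" by simp_all
  let ?f = "\<lambda>z. (if adjacent G (vs ! i) z then 1 else 0) * real_of_int (signed_count z (vs ! j))"
  have "(adjacency_mat G vs * count_mat vs) $$ (i, j) = (\<Sum>k\<in>{0..<length vs}. ?f (vs ! k))"
    using ij by (simp add: adjacency_mat_def count_mat_def scalar_prod_def)
  also have "\<dots> = sum ?f V"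
    using sum.reindex_bij_betw[OF bij_betw_nth[OF vs(1) atLeast0LessThan vs(2)[symmetric]], of ?f]
    by simp
  also have "\<dots> = (\<Sum>z\<in>{z. adjacent G (vs ! i) z}. real_of_int (signed_count z (vs ! j)))"
    using finite_V adjacent_verts(2)[OF graph] by (intro sum.mono_neutral_cong_right) auto
  also have "\<dots> = (if vs ! i = vs ! j then 1 else 0)"
    using sum_signed_count[of "vs ! i" "vs ! j"] ij vs(2) nth_mem[OF ij(1)]
    by (simp flip: of_int_sum)
  finally show "(adjacency_mat G vs * count_mat vs) $$ (i, j) = 1\<^sub>m (length vs) $$ (i, j)"
    using ij vs(1) by (simp add: nth_eq_iff_index_eq)
qed (auto simp: adjacency_mat_def count_mat_def)

text \<open>A two-sided inverse is unique, so the quantifier over all inverses concerns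
  \<open>count_mat vs\<close> alone.\<close>

lemma sign_invertible_mat_iff:
  assumes vs: "distinct vs" "set vs = V"
  shows "sign_invertible_mat (adjacency_mat G vs) \<longleftrightarrow> elements_mat (count_mat vs) \<subseteq> {- 1, 0, 1}"
proof -
  let ?n = "length vs"
  let ?A = "adjacency_mat G vs" and ?B = "count_mat vs"
  have A: "?A \<in> carrier_mat ?n ?n" and B: "?B \<in> carrier_mat ?n ?n"
    by (simp_all add: adjacency_mat_def count_mat_def)
  have AB: "?A * ?B = 1\<^sub>m ?n" using adjacency_mat_inverse[OF vs] .
  have BA: "?B * ?A = 1\<^sub>m ?n" using mat_mult_left_right_inverse[OF A B AB] .
  have inv: "inverts_mat ?A ?B" "inverts_mat ?B ?A"
    using A B AB BA by (auto simp: inverts_mat_def)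
  have uniq: "C = ?B" if C: "inverts_mat ?A C" "inverts_mat C ?A" for C
  proof -
    have AC: "?A * C = 1\<^sub>m ?n" and CA: "C * ?A = 1\<^sub>m (dim_row C)"
      using C A by (auto simp: inverts_mat_def)
    \<comment> \<open>\<open>inverts_mat\<close> does not fix the shape of \<open>C\<close>: its
      columns are counted by the product \<open>?A * C\<close>, its rows by
      \<open>C * ?A\<close>.\<close>
    have "dim_col C = ?n" using arg_cong[OF AC, of dim_col] by simp
    moreover have "dim_row C = ?n" using arg_cong[OF CA, of dim_col] A by simp
    ultimately have Cc: "C \<in> carrier_mat ?n ?n" by auto
    have "C = (?B * ?A) * C" using BA Cc by simp
    also have "\<dots> = ?B * (?A * C)" using B A Cc by (rule assoc_mult_mat)
    also have "\<dots> = ?B" using AC B by simp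
    finally show ?thesis .
  qed
  have "invertible_mat ?A"
    unfolding invertible_mat_def using inv A by (metis carrier_matD square_mat.simps)
  then show ?thesis
    using inv uniq unfolding sign_invertible_mat_def by blast
qed

lemma elements_count_mat:
  assumes "set vs = V"
  shows "elements_mat (count_mat vs) = (\<lambda>(x, y). of_int (signed_count x y)) ` (V \<times> V)"
  unfolding assms[symmetric]
  by (force simp: elements_mat_def count_mat_def in_set_conv_nth image_iff)

text \<open>The set of entries does not depend on the enumeration, so the existential over
  \<open>vs\<close> reduces to the existence of some enumeration of the finite vertex set.\<close>

lemma sign_invertible_iff:
  "sign_invertible G \<longleftrightarrow> (\<forall>x\<in>V. \<forall>y\<in>V. essential_index G x y \<in> {0, 1})"
proof -
  have unit: "real_of_int k \<in> {- 1, 0, 1} \<longleftrightarrow> \<bar>k\<bar> \<in> {0, 1}" for k by auto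
  let ?S = "(\<lambda>(x, y). real_of_int (signed_count x y)) ` (V \<times> V)"
  have iff: "sign_invertible_mat (adjacency_mat G vs) \<longleftrightarrow> ?S \<subseteq> {- 1, 0, 1}"
    if "distinct vs" "set vs = V" for vs
    using sign_invertible_mat_iff[OF that] elements_count_mat[OF that(2)] by simp
  obtain vs where "set vs = V" "distinct vs" using finite_distinct_list[OF finite_V] by blast
  then have "sign_invertible G \<longleftrightarrow> ?S \<subseteq> {- 1, 0, 1}"
    using iff unfolding sign_invertible_def by blast
  also have "\<dots> \<longleftrightarrow> (\<forall>x\<in>V. \<forall>y\<in>V. real_of_int (signed_count x y) \<in> {- 1, 0, 1})"
    unfolding image_subset_iff by (simp only: Ball_def mem_Times_iff split_paired_All split fst_conv snd_conv) blast
  finally show ?thesis by (simp only: unit essential_index_eq)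
qed

end

theorem theorem4p8:
  fixes G :: "'a ugraph"
  assumes "finite_simple_graph G"
    and "bipartite G"
    and "K2_reducible G"
  shows "sign_invertible G \<longleftrightarrow>
    (\<forall>x \<in> verts G. \<forall>y \<in> verts G. essential_index G x y \<in> {0, 1})"
proof -
  obtain X Y where XY: "X \<inter> Y = {}" "\<forall>e\<in>edges G. \<exists>x\<in>X. \<exists>y\<in>Y. e = {x, y}"
    using assms(2) by (auto simp: bipartite_def)
  \<comment> \<open>Everything outside \<open>X\<close>, vertex or not, gets -1, so that \<sigma> is
    a sign on the whole type.\<close>
  define \<sigma> :: "'a \<Rightarrow> int" where "\<sigma> v = (if v \<in> X then 1 else - 1)" for v
  have "\<sigma> v = - \<sigma> u" if uv: "adjacent G u v" for u v
  proof -
    obtain x y where "x \<in> X" "y \<in> Y" "{u, v} = {x, y}"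
      using XY(2) uv unfolding adjacent_def by blast
    then show ?thesis using XY(1) by (auto simp: \<sigma>_def doubleton_eq_iff)
  qed
  moreover have "\<sigma> v = 1 \<or> \<sigma> v = - 1" for v by (simp add: \<sigma>_def)
  ultimately obtain m r where "ranked_matching G \<sigma> r m"
    using K2_reducible_ranked[OF assms(3,1)] by blast
  then interpret ranked_matching G \<sigma> r m .
  show ?thesis by (rule sign_invertible_iff)
qed

end
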